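(* Let $a=\{a_n\}_{n\ge1}$ be a non-increasing, summable sequence of positive real numbers, with tails $r_n^{(a)}=\sum_{j\ge n}a_j$ and associated Cantor set $C_a$. Then $$\mathcal{H}_\alpha^{C_a}=\Big\{h\in\mathcal{D}:\liminf_{n\to\infty}n\,h\big(r_n^{(a)}/n\big)=\alpha\Big\}\ \text{ for }\alpha=0,\infty,\qquad \mathcal{H}_1^{C_a}=\Big\{h\in\mathcal{D}:0<\liminf_{n\to\infty}n\,h\big(r_n^{(a)}/n\big)<\infty\Big\},$$ and $$\mathcal{P}_\beta^{C_a}=\Big\{h\in\mathcal{D}:\limsup_{n\to\infty}n\,h\big(r_n^{(a)}/n\big)=\beta\Big\}\ \text{ for }\beta=0,\infty,\qquad \mathcal{P}_1^{C_a}=\Big\{h\in\mathcal{D}:0<\limsup_{n\to\infty}n\,h\big(r_n^{(a)}/n\big)<\infty\Big\}.$$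
   Context: Dimension functions: a function $h$ on an interval $(0,A]$ is increasing if $h(x)<h(y)$ whenever $x<y$, and doubling if there is $\tau>0$ with $h(x)\ge\tau h(2x)$ for all $x$ with $x,2x$ in the domain. A dimension function is a continuous, increasing, doubling function $h:(0,A]\to(0,\infty)$ (for some $A>0$, which may depend on $h$) with $h(x)\to0$ as $x\to0^+$; put $h(0)=0$. $\mathcal{D}$ is the set of dimension functions. (Since $r_n^{(a)}/n\to0$, $h(r_n^{(a)}/n)$ is defined for all large $n$.) Measures: for $E\subseteq\mathbb{R}$, with $|B|$ the diameter of $B$, $H^h(E)=\lim_{\delta\to0^+}\inf\{\sum_i h(|E_i|): E\subseteq\bigcup_i E_i,\ |E_i|\le\delta\}$ (countable covers). A $\delta$-packing of $E$ is a disjoint family of open balls (open intervals) centered at points of $E$ with diameters less than $\delta$. The $h$-packing pre-measure is $P_0^h(E)=\lim_{\delta\to0^+}\sup\{\sum_i h(|B_i|):\{B_i\}\text{ a }\delta\text{-packing of }E\}$, and the $h$-packing measure is $P^h(E)=\inf\{\sum_{i=1}^\infty P_0^h(E_i): E=\bigcup_{i=1}^\infty E_i\}$. Notation: $\mathcal{H}_\alpha^E=\{h\in\mathcal{D}:H^h(E)=\alpha\}$ for $\alpha=0,\infty$ and $\mathcal{H}_1^E=\{h\in\mathcal{D}:0<H^h(E)<\infty\}$; $\mathcal{P}_\beta^E$ is defined in the same way with $P^h$ in place of $H^h$. The Cantor set $C_a$: for a positive, non-increasing, summable $a$, set $\ell_n=\sum_{k\ge0}\sum_{j=0}^{2^k-1}a_{2^kn+j}$,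 so $\ell_1=\sum_n a_n$ and $\ell_n=a_n+\ell_{2n}+\ell_{2n+1}$. Let $I_1$ be a closed interval of length $\ell_1$; given the closed interval $I_n$ of length $\ell_n$, remove from it an open interval of length $a_n$ so that the remaining left closed interval $I_{2n}$ has length $\ell_{2n}$ and the remaining right closed interval $I_{2n+1}$ has length $\ell_{2n+1}$. Then $C_a=\bigcap_{k\ge0}\bigcup_{n=2^k}^{2^{k+1}-1}I_n$. *)

theory Defs
  imports "HOL-Analysis.Analysis"
begin

section \<open>Dimension functions\<close>

text \<open>
  A dimension function \<open>h : (0,A] \<rightarrow> (0,\<infinity>)\<close> is encoded by its extension by zero to all reals.
  This covers the convention \<open>h 0 = 0\<close>, and it is a one-to-one encoding of functions together
  with their domains, as \<open>(0,A]\<close> is recovered as the set where \<open>h\<close> is nonzero. The values of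
  \<open>h\<close> beyond \<open>A\<close> are placeholders; everything below involves \<open>h\<close> only through limits at \<open>0\<close>.
\<close>

definition dimension_function_on :: "real \<Rightarrow> (real \<Rightarrow> real) \<Rightarrow> bool" where
  "dimension_function_on A h \<longleftrightarrow>
     continuous_on {0<..A} h \<and>
     strict_mono_on {0<..A} h \<and>
     (\<exists>\<tau>>0. \<forall>x. x \<in> {0<..A} \<and> 2 * x \<in> {0<..A} \<longrightarrow> h x \<ge> \<tau> * h (2 * x)) \<and>
     (\<forall>x\<in>{0<..A}. h x > 0) \<and>
     (h \<longlongrightarrow> 0) (at_right 0) \<and>
     (\<forall>x. x \<notin> {0<..A} \<longrightarrow> h x = 0)"

definition dimension_functions :: "(real \<Rightarrow> real) set" where
  "dimension_functions = {h. \<exists>A>0. dimension_function_on A h}"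


section \<open>Hausdorff and packing measures\<close>

text \<open>
  Boundedness is required explicitly because \<^const>\<open>diameter\<close> is a real number and carries no
  information for unbounded sets. Some of the sets may be empty, so finite covers are included.
\<close>

definition delta_covers :: "real \<Rightarrow> real set \<Rightarrow> (nat \<Rightarrow> real set) set" where
  "delta_covers \<delta> E =
     {U. E \<subseteq> (\<Union>i. U i) \<and> (\<forall>i. bounded (U i) \<and> diameter (U i) \<le> \<delta>)}"

definition hausdorff_measure :: "(real \<Rightarrow> real) \<Rightarrow> real set \<Rightarrow> ennreal" where
  "hausdorff_measure h E =
     Lim (at_right 0) (\<lambda>\<delta>. INF U\<in>delta_covers \<delta> E. \<Sum>i. ennreal (h (diameter (U i))))"

definition delta_packings :: "real \<Rightarrow> real set \<Rightarrow> real set set set" where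
  "delta_packings \<delta> E =
     {\<B>. disjoint \<B> \<and> (\<forall>B\<in>\<B>. (\<exists>x\<in>E. \<exists>r>0. B = ball x r) \<and> diameter B < \<delta>)}"

definition packing_premeasure :: "(real \<Rightarrow> real) \<Rightarrow> real set \<Rightarrow> ennreal" where
  "packing_premeasure h E =
     Lim (at_right 0)
       (\<lambda>\<delta>. SUP \<B>\<in>delta_packings \<delta> E. \<Sum>\<^sub>\<infinity>B\<in>\<B>. ennreal (h (diameter B)))"

definition packing_measure :: "(real \<Rightarrow> real) \<Rightarrow> real set \<Rightarrow> ennreal" where
  "packing_measure h E =
     (INF F\<in>{F :: nat \<Rightarrow> real set. E = (\<Union>i. F i)}. \<Sum>i. packing_premeasure h (F i))"

text \<open>
  The classes with subscripts \<open>0\<close> and \<open>\<infinity>\<close> prescribe the value of the measure, whereas the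
  subscript \<open>1\<close> stands for a positive finite measure; the latter are the classes \<open>_pos_fin\<close>.
\<close>

definition hausdorff_class :: "ennreal \<Rightarrow> real set \<Rightarrow> (real \<Rightarrow> real) set" where
  "hausdorff_class \<alpha> E = {h \<in> dimension_functions. hausdorff_measure h E = \<alpha>}"

definition hausdorff_class_pos_fin :: "real set \<Rightarrow> (real \<Rightarrow> real) set" where
  "hausdorff_class_pos_fin E =
     {h \<in> dimension_functions. 0 < hausdorff_measure h E \<and> hausdorff_measure h E < \<infinity>}"

definition packing_class :: "ennreal \<Rightarrow> real set \<Rightarrow> (real \<Rightarrow> real) set" where
  "packing_class \<beta> E = {h \<in> dimension_functions. packing_measure h E = \<beta>}"

definition packing_class_pos_fin :: "real set \<Rightarrow> (real \<Rightarrow> real) set" where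
  "packing_class_pos_fin E =
     {h \<in> dimension_functions. 0 < packing_measure h E \<and> packing_measure h E < \<infinity>}"


section \<open>The Cantor set of a sequence\<close>

text \<open>Sequences are indexed from \<open>1\<close>; the value \<open>a 0\<close> is never relevant.\<close>

definition tail_sum :: "(nat \<Rightarrow> real) \<Rightarrow> nat \<Rightarrow> real" where
  "tail_sum a n = (\<Sum>j. a (n + j))"

definition cantor_length :: "(nat \<Rightarrow> real) \<Rightarrow> nat \<Rightarrow> real" where
  "cantor_length a n = (\<Sum>k. \<Sum>j<2 ^ k. a (2 ^ k * n + j))"

text \<open>
  The left endpoint of the \<open>n\<close>-th interval, where \<open>c\<close> is the (arbitrary) left endpoint of the
  first one. The interval \<open>2m\<close> starts where the interval \<open>m\<close> does; the interval \<open>2m + 1\<close> starts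
  after the interval \<open>2m\<close> and the removed gap of length \<open>a m\<close>.
\<close>

fun cantor_left :: "(nat \<Rightarrow> real) \<Rightarrow> real \<Rightarrow> nat \<Rightarrow> real" where
  "cantor_left a c n =
     (if n \<le> 1 then c
      else if even n then cantor_left a c (n div 2)
      else cantor_left a c (n div 2) + cantor_length a (n - 1) + a (n div 2))"

declare cantor_left.simps [simp del]

definition cantor_interval :: "(nat \<Rightarrow> real) \<Rightarrow> real \<Rightarrow> nat \<Rightarrow> real set" where
  "cantor_interval a c n = {cantor_left a c n .. cantor_left a c n + cantor_length a n}"

definition cantor_set :: "(nat \<Rightarrow> real) \<Rightarrow> real \<Rightarrow> real set" where
  "cantor_set a c = (\<Inter>k. \<Union>n\<in>{2 ^ k..<2 ^ (k + 1)}. cantor_interval a c n)"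

end

theory Submission
  imports Defs
begin

text \<open>
  Let \<open>s k = tail_sum a (2 ^ k) / 2 ^ k\<close> be the mean length of the intervals of level \<open>k\<close>. As
  lengths decrease along the numbering, every interval of level \<open>k\<close> has length between
  \<open>s (k + 1)\<close> and \<open>s (k - 1)\<close>; this makes the Cantor set behave like a homogeneous one. Write
  \<open>g n = n h (tail_sum a n / n)\<close>, which for \<open>2 ^ k \<le> n < 2 ^ (k + 1)\<close> lies between
  \<open>2 ^ k h (s (k + 1))\<close> and \<open>2 ^ (k + 1) h (s k)\<close>. Then, with \<open>\<tau>\<close> the doubling constant,
  \<open>liminf g / 8 \<le> H\<^sup>h \<le> 4 liminf g\<close> and \<open>limsup g / 8 \<le> P\<^sup>h \<le> (4 / \<tau>) limsup g\<close>:

  \<^item> Covering by the intervals of one level bounds \<open>H\<^sup>h\<close> from above. From below, a set with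
    diameter in \<open>[s (k + 1), s k)\<close> meets at most two intervals of level \<open>k - 1\<close>, so its uniform
    mass is at most \<open>8 / 2 ^ (k + 1)\<close>.

  \<^item> A ball centred in the Cantor set with radius in \<open>(s (k + 1), s k]\<close> contains an interval of
    level \<open>k + 2\<close>, so its uniform mass is at least \<open>1 / 2 ^ (k + 2)\<close>; this bounds packings from
    above. From below, half of the intervals of level \<open>k - 1\<close> that meet \<open>E\<close> carry disjoint balls
    of diameter up to \<open>s k\<close> centred in \<open>E\<close>, so the pre-measure of every \<open>E\<close> is at least
    \<open>limsup g / 8\<close> times its uniform mass.
\<close>

section \<open>Dyadic cells\<close>

text \<open>The cell stands for the interval numbered \<open>2 ^ k + p\<close>; its Lebesgue measure
  is the mass that the uniform measure gives to that interval. Cells are half-open so that those of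
  one level with \<open>p < 2 ^ k\<close> partition \<open>{0..<1}\<close>.\<close>

definition dyadic_cell :: "nat \<Rightarrow> nat \<Rightarrow> real set" where
  "dyadic_cell k p = {real p / 2 ^ k..<real (Suc p) / 2 ^ k}"

lemma emeasure_dyadic_cell: "emeasure lborel (dyadic_cell k p) = ennreal (1 / 2 ^ k)"
proof -
  have "real (Suc p) / 2 ^ k - real p / 2 ^ k = 1 / 2 ^ k"
    by (simp add: diff_divide_distrib [symmetric])
  moreover have "real p / 2 ^ k \<le> real (Suc p) / 2 ^ k"
    by (simp add: divide_right_mono)
  ultimately show ?thesis
    unfolding dyadic_cell_def by simp
qed

lemma sets_dyadic_cell: "dyadic_cell k p \<in> sets borel"
  by (simp add: dyadic_cell_def)

lemma dyadic_cell_subset_unit: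
  assumes "p < 2 ^ k"
  shows "dyadic_cell k p \<subseteq> {0..<1}"
proof -
  have "real (Suc p) \<le> real (2 ^ k)"
    using assms by (simp only: of_nat_le_iff)
  then have "real (Suc p) / 2 ^ k \<le> 1"
    by (simp add: divide_le_eq)
  moreover have "0 \<le> real p / 2 ^ k" by simp
  ultimately show ?thesis
    unfolding dyadic_cell_def by (intro ivl_subset [THEN iffD2]) simp
qed

text \<open>For \<open>t\<close> in \<open>{0..<1}\<close> these are the first \<open>k\<close>
  binary digits, read as a number.\<close>

definition dyadic_index :: "nat \<Rightarrow> real \<Rightarrow> nat" where
  "dyadic_index k t = nat \<lfloor>t * 2 ^ k\<rfloor>"

lemma mem_dyadic_cell_iff:
  assumes "0 \<le> t"
  shows "t \<in> dyadic_cell k p \<longleftrightarrow> dyadic_index k t = p"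
proof -
  have "t \<in> dyadic_cell k p \<longleftrightarrow> real p \<le> t * 2 ^ k \<and> t * 2 ^ k < real p + 1"
    by (simp add: dyadic_cell_def divide_le_eq less_divide_eq add.commute)
  also have "\<dots> \<longleftrightarrow> \<lfloor>t * 2 ^ k\<rfloor> = int p"
    by (simp add: floor_eq_iff)
  also have "\<dots> \<longleftrightarrow> dyadic_index k t = p"
    using assms by (auto simp: dyadic_index_def)
  finally show ?thesis .
qed

lemma dyadic_index_less:
  assumes "0 \<le> t" "t < 1"
  shows "dyadic_index k t < 2 ^ k"
proof -
  have "t * 2 ^ k < 2 ^ k" using assms by simp
  then have "\<lfloor>t * 2 ^ k\<rfloor> < 2 ^ k" by (simp add: floor_less_iff)
  then show ?thesis using assms by (simp add: dyadic_index_def nat_less_iff)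
qed

text \<open>Dropping the last binary digit passes to the parent cell, just as \<open>n div 2\<close>
  numbers the parent of interval \<open>n\<close>.\<close>

lemma dyadic_index_Suc:
  assumes "0 \<le> t"
  shows "dyadic_index (Suc k) t div 2 = dyadic_index k t"
proof -
  define p where "p = dyadic_index (Suc k) t"
  have "t \<in> dyadic_cell (Suc k) p"
    using mem_dyadic_cell_iff [OF assms] p_def by blast
  then have *: "real p \<le> 2 * (t * 2 ^ k)" "2 * (t * 2 ^ k) < real p + 1"
    by (auto simp: dyadic_cell_def divide_le_eq less_divide_eq field_simps)
  have "2 * (p div 2) \<le> p" "p \<le> 2 * (p div 2) + 1" by auto
  then have "2 * real (p div 2) \<le> real p" "real p \<le> 2 * real (p div 2) + 1"
    by linarith+
  with * have "real (p div 2) \<le> t * 2 ^ k" "t * 2 ^ k < real (p div 2) + 1"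
    by linarith+
  then have "t \<in> dyadic_cell k (p div 2)"
    by (simp add: dyadic_cell_def divide_le_eq less_divide_eq add.commute)
  then show ?thesis
    using mem_dyadic_cell_iff [OF assms] p_def by simp
qed

section \<open>Lengths and positions of the intervals\<close>

locale cantor_sequence =
  fixes a :: "nat \<Rightarrow> real" and c :: real
  assumes pos: "1 \<le> n \<Longrightarrow> 0 < a n"
    and decr: "1 \<le> m \<Longrightarrow> m \<le> n \<Longrightarrow> a n \<le> a m"
    and summ: "summable a"
begin

abbreviation "len \<equiv> cantor_length a"
abbreviation "left \<equiv> cantor_left a c"
abbreviation "ival \<equiv> cantor_interval a c"

text \<open>
  At \<open>n = 2 ^ k\<close> this is the mean length of the \<open>2 ^ k\<close> intervals of level \<open>k\<close>.
\<close>

definition avg :: "nat \<Rightarrow> real" where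
  "avg n = tail_sum a n / real n"

section \<open>Lengths as sums of gaps by generation\<close>

text \<open>The total length of the gaps removed \<open>k\<close> generations below interval
  \<open>n\<close>; summed over \<open>k\<close> it gives \<open>len n\<close>.\<close>

definition block :: "nat \<Rightarrow> nat \<Rightarrow> real" where
  "block n k = (\<Sum>j<2 ^ k. a (2 ^ k * n + j))"

lemma block_pos:
  assumes "1 \<le> n"
  shows "0 < block n k"
  unfolding block_def
proof (rule sum_pos)
  fix j :: nat
  have "1 \<le> 2 ^ k * n" using assms by simp
  then show "0 < a (2 ^ k * n + j)" by (intro pos) linarith
qed (simp_all add: lessThan_empty_iff)

lemma block_anti:
  assumes "1 \<le> m" "m \<le> n"
  shows "block n k \<le> block m k"
  unfolding block_def
proof (rule sum_mono)
  fix j :: nat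
  have "1 \<le> 2 ^ k * m" "2 ^ k * m \<le> 2 ^ k * n" using assms by simp_all
  then show "a (2 ^ k * n + j) \<le> a (2 ^ k * m + j)" by (intro decr) linarith+
qed

lemma block_0: "block n 0 = a n"
  by (simp add: block_def)

text \<open>The descendants, \<open>k\<close> generations down, of the intervals of level
  \<open>i\<close> are exactly the intervals of level \<open>k + i\<close>. Division by
  \<open>2 ^ k\<close> recovers the ancestor, the remainder its offset.\<close>

lemma sum_block: "(\<Sum>n\<in>{2 ^ i..<2 ^ Suc i}. block n k) = (\<Sum>m\<in>{2 ^ (k + i)..<2 ^ Suc (k + i)}. a m)"
proof -
  have "(\<Sum>n\<in>{2 ^ i..<2 ^ Suc i}. block n k)
      = (\<Sum>(n, j)\<in>{2 ^ i..<2 ^ Suc i} \<times> {..<2 ^ k}. a (2 ^ k * n + j))"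
    by (simp add: block_def sum.cartesian_product)
  also have "\<dots> = (\<Sum>m\<in>{2 ^ (k + i)..<2 ^ Suc (k + i)}. a m)"
  proof (rule sum.reindex_bij_witness
      [where i = "\<lambda>m. (m div 2 ^ k, m mod 2 ^ k)" and j = "\<lambda>(n, j). 2 ^ k * n + j"])
    fix x :: "nat \<times> nat"
    assume x: "x \<in> {2 ^ i..<2 ^ Suc i} \<times> {..<2 ^ k}"
    obtain n j where [simp]: "x = (n, j)" by force
    have n: "2 ^ i \<le> n" "Suc n \<le> 2 ^ Suc i" and j: "j < 2 ^ k" using x by auto
    have "2 ^ k * 2 ^ i \<le> 2 ^ k * n" "2 ^ k * Suc n \<le> 2 ^ k * 2 ^ Suc i"
      using n by (intro mult_le_mono; simp)+
    then show "(case x of (n, j) \<Rightarrow> 2 ^ k * n + j) \<in> {2 ^ (k + i)..<2 ^ Suc (k + i)}"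
      using j by (simp add: power_add trans_le_add1)
    show "((case x of (n, j) \<Rightarrow> 2 ^ k * n + j) div 2 ^ k,
        (case x of (n, j) \<Rightarrow> 2 ^ k * n + j) mod 2 ^ k) = x"
      using j by simp
  next
    fix m :: nat
    assume m: "m \<in> {2 ^ (k + i)..<2 ^ Suc (k + i)}"
    have "2 ^ i \<le> m div 2 ^ k" "m div 2 ^ k < 2 ^ Suc i"
      using m by (simp_all add: less_eq_div_iff_mult_less_eq div_less_iff_less_mult power_add ac_simps)
    then show "(m div 2 ^ k, m mod 2 ^ k) \<in> {2 ^ i..<2 ^ Suc i} \<times> {..<2 ^ k}"
      by simp
    show "(case (m div 2 ^ k, m mod 2 ^ k) of (n, j) \<Rightarrow> 2 ^ k * n + j) = m" by simp
  qed auto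
  finally show ?thesis .
qed

lemma tail_sum_sums: "(\<lambda>k. a (n + k)) sums tail_sum a n"
  unfolding tail_sum_def using summ summable_iff_shift [of a n]
  by (auto simp: add.commute intro: summable_sums)

lemma sums_levels: "(\<lambda>k. \<Sum>m\<in>{2 ^ (k + i)..<2 ^ Suc (k + i)}. a m) sums tail_sum a (2 ^ i)"
proof -
  have eq: "(\<Sum>k<K. \<Sum>m\<in>{2 ^ (k + i)..<2 ^ Suc (k + i)}. a m) = (\<Sum>j<2 ^ (K + i) - 2 ^ i. a (2 ^ i + j))" for K
  proof -
    have "(\<Sum>k<K. \<Sum>m\<in>{2 ^ (k + i)..<2 ^ Suc (k + i)}. a m) = (\<Sum>m\<in>{2 ^ i..<2 ^ (K + i)}. a m)"
    proof (induction K)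
      case (Suc K)
      have "(2::nat) ^ i \<le> 2 ^ (K + i)" "(2::nat) ^ (K + i) \<le> 2 ^ Suc (K + i)" by simp_all
      with Suc show ?case by (simp add: sum.atLeastLessThan_concat)
    qed simp
    also have "\<dots> = (\<Sum>j<2 ^ (K + i) - 2 ^ i. a (2 ^ i + j))"
      by (rule sum.reindex_bij_witness [where i = "\<lambda>j. 2 ^ i + j" and j = "\<lambda>m. m - 2 ^ i"]) auto
    finally show ?thesis .
  qed
  \<comment> \<open>Summing level by level runs through a subsequence of the partial sums of the
    tail, so it remains to see that the indices tend to infinity.\<close>
  have "filterlim (\<lambda>K. 2 ^ (K + i) - 2 ^ i :: nat) sequentially sequentially"
  proof (rule filterlim_at_top_mono [OF filterlim_ident])
    have "K \<le> 2 ^ (K + i) - 2 ^ i" for K :: nat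
    proof -
      have "Suc K \<le> 2 ^ K" by (simp add: Suc_leI)
      then have "Suc K * 2 ^ i \<le> 2 ^ (K + i)" unfolding power_add by (rule mult_le_mono1)
      moreover have "K \<le> K * 2 ^ i" by simp
      ultimately show ?thesis unfolding mult_Suc by linarith
    qed
    then show "\<forall>\<^sub>F K in sequentially. K \<le> 2 ^ (K + i) - (2 ^ i :: nat)" by simp
  qed
  from filterlim_compose [OF tail_sum_sums [unfolded sums_def] this]
  show ?thesis unfolding sums_def eq .
qed

text \<open>\<open>cantor_length\<close> is a \<open>suminf\<close>, so convergence has to be shown:
  the block of \<open>n\<close> is dominated by the gaps of a whole level, which are summable over
  the levels.\<close>

lemma sums_len:
  assumes "1 \<le> n"
  shows "block n sums len n"
proof -
  obtain i where i: "2 ^ i \<le> n" "n < 2 ^ Suc i"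
    using ex_power_ivl1 [of 2 n] assms by auto
  have "summable (block n)"
  proof (rule summable_comparison_test')
    show "summable (\<lambda>k. \<Sum>m\<in>{2 ^ (k + i)..<2 ^ Suc (k + i)}. a m)"
      using sums_levels sums_summable by blast
    fix k :: nat
    have "block n k \<le> (\<Sum>n\<in>{2 ^ i..<2 ^ Suc i}. block n k)"
    proof (rule member_le_sum)
      show "n \<in> {2 ^ i..<2 ^ Suc i}" using i by simp
      fix m :: nat
      assume "m \<in> {2 ^ i..<2 ^ Suc i} - {n}"
      then have "(2 :: nat) ^ i \<le> m" by simp
      moreover have "1 \<le> (2 :: nat) ^ i" by simp
      ultimately have "1 \<le> m" by linarith
      then show "0 \<le> block m k" using block_pos less_imp_le by blast
    qed simp
    then show "norm (block n k) \<le> (\<Sum>m\<in>{2 ^ (k + i)..<2 ^ Suc (k + i)}. a m)"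
      using block_pos [OF assms, of k] by (simp add: sum_block del: power_Suc)
  qed
  then show ?thesis
    unfolding cantor_length_def by (simp add: block_def [abs_def] summable_sums)
qed

lemma len_pos:
  assumes "1 \<le> n"
  shows "0 < len n"
  using suminf_pos [of "block n"] sums_len [OF assms] block_pos [OF assms] by (simp add: sums_iff)

lemma len_anti:
  assumes "1 \<le> m" "m \<le> n"
  shows "len n \<le> len m"
  by (rule sums_le [OF block_anti [OF assms] sums_len sums_len]) (use assms in simp_all)

text \<open>Generation \<open>0\<close> is the gap of \<open>n\<close> itself; every later
  generation splits into a first half below \<open>2 * n\<close> and a second half below
  \<open>2 * n + 1\<close>.\<close>

lemma len_split:
  assumes "1 \<le> n"
  shows "len n = a n + len (2 * n) + len (2 * n + 1)"
proof -
  have "block n (Suc k) = block (2 * n) k + block (2 * n + 1) k" for k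
  proof -
    have "(\<Sum>j<2 ^ k + N. a (2 ^ Suc k * n + j))
        = (\<Sum>j<2 ^ k. a (2 ^ Suc k * n + j)) + (\<Sum>j<N. a (2 ^ Suc k * n + (2 ^ k + j)))" for N
      by (induction N) simp_all
    from this [of "2 ^ k"] show ?thesis
      by (simp add: block_def mult_2 algebra_simps)
  qed
  moreover have "(\<lambda>k. block (2 * n) k + block (2 * n + 1) k) sums (len (2 * n) + len (2 * n + 1))"
    using assms by (intro sums_add sums_len) simp_all
  ultimately have "(\<lambda>k. block n (Suc k)) sums (len (2 * n) + len (2 * n + 1))"
    by simp
  then have "block n sums (len (2 * n) + len (2 * n + 1) + block n 0)"
    by (simp only: sums_Suc_iff)
  then show ?thesis
    using sums_len [OF assms] sums_unique2 block_0 by fastforce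
qed

lemma sum_len: "(\<Sum>n\<in>{2 ^ i..<2 ^ Suc i}. len n) = tail_sum a (2 ^ i)"
proof -
  have "(\<lambda>k. \<Sum>n\<in>{2 ^ i..<2 ^ Suc i}. block n k) sums (\<Sum>n\<in>{2 ^ i..<2 ^ Suc i}. len n)"
  proof (rule sums_sum)
    fix n :: nat
    assume "n \<in> {2 ^ i..<2 ^ Suc i}"
    then have "(2 :: nat) ^ i \<le> n" by simp
    moreover have "1 \<le> (2 :: nat) ^ i" by simp
    ultimately show "block n sums len n" by (intro sums_len) linarith
  qed
  from sums_unique2 [OF this [unfolded sum_block] sums_levels] show ?thesis .
qed

section \<open>Lengths against mean lengths\<close>

lemma len_le_avg:
  assumes "2 ^ Suc k \<le> n"
  shows "len n \<le> avg (2 ^ k)"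
proof -
  have "real (card {2 ^ k..<2 ^ Suc k :: nat}) * len n \<le> (\<Sum>m\<in>{2 ^ k..<2 ^ Suc k}. len m)"
  proof (rule sum_bounded_below)
    fix m :: nat
    assume "m \<in> {2 ^ k..<2 ^ Suc k}"
    then have "2 ^ k \<le> m" "m \<le> n" using assms by auto
    moreover have "1 \<le> (2 :: nat) ^ k" by simp
    ultimately show "len n \<le> len m" by (intro len_anti) linarith+
  qed
  then have "2 ^ k * len n \<le> tail_sum a (2 ^ k)"
    by (simp add: sum_len del: power_Suc) (simp add: mult.commute)
  then show ?thesis by (simp add: avg_def field_simps)
qed

text \<open>All of level \<open>k\<close> comes after \<open>n\<close> in the numbering, hence is no
  longer than interval \<open>n\<close>. Together with \<open>len_le_avg\<close> this confines each
  length of level \<open>k \<ge> 1\<close> between the means of levels \<open>k + 1\<close> and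
  \<open>k - 1\<close>.\<close>

lemma avg_le_len:
  assumes "1 \<le> n" "n < 2 ^ k"
  shows "avg (2 ^ k) \<le> len n"
proof -
  have "(\<Sum>m\<in>{2 ^ k..<2 ^ Suc k}. len m) \<le> real (card {2 ^ k..<2 ^ Suc k :: nat}) * len n"
    by (rule sum_bounded_above) (use assms in \<open>auto intro!: len_anti\<close>)
  then have "tail_sum a (2 ^ k) \<le> 2 ^ k * len n"
    by (simp add: sum_len del: power_Suc) (simp add: mult.commute)
  then show ?thesis by (simp add: avg_def field_simps)
qed

lemma tail_sum_anti:
  assumes "1 \<le> m" "m \<le> n"
  shows "tail_sum a n \<le> tail_sum a m"
  using sums_le [OF _ tail_sum_sums tail_sum_sums] assms decr by (simp add: trans_le_add1)

lemma tail_sum_pos: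
  assumes "1 \<le> n"
  shows "0 < tail_sum a n"
  using suminf_pos [of "\<lambda>k. a (n + k)"] tail_sum_sums [of n] pos assms by (simp add: sums_iff)

lemma avg_pos: "1 \<le> n \<Longrightarrow> 0 < avg n"
  by (simp add: avg_def tail_sum_pos)

lemma avg_anti:
  assumes "1 \<le> m" "m \<le> n"
  shows "avg n \<le> avg m"
  unfolding avg_def using assms tail_sum_anti tail_sum_pos [of m]
  by (intro frac_le) auto

lemma avg_tendsto_0: "avg \<longlonglongrightarrow> 0"
proof (rule tendsto_sandwich [where f = "\<lambda>_. 0" and h = "\<lambda>n. tail_sum a 1 / real n"])
  show "\<forall>\<^sub>F n in sequentially. 0 \<le> avg n"
    using eventually_ge_at_top [of 1] by eventually_elim (use avg_pos less_imp_le in blast)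
  show "\<forall>\<^sub>F n in sequentially. avg n \<le> tail_sum a 1 / real n"
    using eventually_ge_at_top [of 1]
    by eventually_elim (simp add: avg_def tail_sum_anti divide_right_mono)
qed (auto intro: lim_const_over_n)

lemma avg_pow2_tendsto_0: "(\<lambda>k. avg (2 ^ k)) \<longlonglongrightarrow> 0"
  by (rule filterlim_compose [OF avg_tendsto_0])
    (auto intro!: filterlim_subseq strict_monoI)

section \<open>Positions of the intervals on the line\<close>

lemma left_even: "1 \<le> n \<Longrightarrow> left (2 * n) = left n"
  by (subst cantor_left.simps) simp

lemma left_odd: "1 \<le> n \<Longrightarrow> left (2 * n + 1) = left n + len (2 * n) + a n"
  by (subst cantor_left.simps) simp

lemma ival_nested:
  assumes "1 \<le> n"
  shows "ival (2 * n) \<subseteq> ival n" "ival (2 * n + 1) \<subseteq> ival n"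
  using len_split [OF assms] len_pos [of "2 * n"] len_pos [of "2 * n + 1"] pos [OF assms] assms
    left_even [OF assms] left_odd [OF assms]
  by (auto simp: cantor_interval_def simp del: One_nat_def)

text \<open>Neighbours with a common parent are separated by the gap of the parent; neighbours with
  different parents inherit the separation of the parents, by induction on the level.\<close>

lemma right_less_left_Suc:
  "Suc p < 2 ^ k \<Longrightarrow> left (2 ^ k + p) + len (2 ^ k + p) < left (2 ^ k + Suc p)"
proof (induction k arbitrary: p)
  case (Suc k)
  define n where "n = 2 ^ k + p div 2"
  have n: "1 \<le> n" by (simp add: n_def Suc_leI)
  show ?case
  proof (cases "even p")
    case True
    then have "2 ^ Suc k + p = 2 * n" "2 ^ Suc k + Suc p = 2 * n + 1" by (auto simp: n_def)
    then show ?thesis using left_even [OF n] left_odd [OF n] pos [OF n] by simp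
  next
    case False
    \<comment> \<open>A right child ends where its parent ends, and its neighbour is a left child,
      which starts where the next parent starts.\<close>
    then have p: "p = 2 * (p div 2) + 1" by presburger
    then have eq: "2 ^ Suc k + p = 2 * n + 1" "2 ^ Suc k + Suc p = 2 * (2 ^ k + Suc (p div 2))"
      by (auto simp: n_def)
    have "Suc (p div 2) < 2 ^ k" using Suc.prems p by simp
    from Suc.IH [OF this] have "left n + len n < left (2 ^ k + Suc (p div 2))"
      by (simp add: n_def)
    also have "\<dots> = left (2 ^ Suc k + Suc p)" unfolding eq by (simp only: left_even Suc_leI)
    finally show ?thesis
      using left_odd [OF n] len_split [OF n] eq(1) by simp
  qed
qed simp

lemma right_less_left:
  assumes "i < j" "j < 2 ^ k"
  shows "left (2 ^ k + i) + len (2 ^ k + i) < left (2 ^ k + j)"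
  using assms
proof (induction j)
  case (Suc j)
  show ?case
  proof (cases "i = j")
    case True
    then show ?thesis using right_less_left_Suc Suc.prems by blast
  next
    case False
    then have "left (2 ^ k + i) + len (2 ^ k + i) < left (2 ^ k + j)"
      using Suc by simp
    also have "\<dots> < left (2 ^ k + j) + len (2 ^ k + j)"
      by (simp add: len_pos Suc_leI)
    also have "\<dots> < left (2 ^ k + Suc j)"
      using right_less_left_Suc Suc.prems by blast
    finally show ?thesis .
  qed
qed simp

text \<open>The interval at position \<open>i + 1\<close> lies entirely between the two points, and
  its length is at least the mean of the next level.\<close>

lemma ival_separated:
  assumes "i + 2 \<le> j" "j < 2 ^ k" "x \<in> ival (2 ^ k + i)" "y \<in> ival (2 ^ k + j)"
  shows "avg (2 ^ Suc k) < y - x"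
proof -
  have "avg (2 ^ Suc k) \<le> len (2 ^ k + Suc i)"
    by (rule avg_le_len) (use assms in auto)
  moreover have "left (2 ^ k + i) + len (2 ^ k + i) < left (2 ^ k + Suc i)"
    by (rule right_less_left) (use assms in auto)
  moreover have "left (2 ^ k + Suc i) + len (2 ^ k + Suc i) < left (2 ^ k + j)"
    by (rule right_less_left) (use assms in auto)
  ultimately show ?thesis
    using assms(3,4) by (auto simp: cantor_interval_def)
qed

end


section \<open>Limit-free forms of the measures\<close>

lemma ennreal_divide_le_iff:
  fixes x y z :: ennreal
  assumes "0 < z" "z < top"
  shows "x / z \<le> y \<longleftrightarrow> x \<le> z * y"
proof
  assume "x / z \<le> y"
  then have "z * (x / z) \<le> z * y" by (rule mult_left_mono) simp
  moreover have "z * (x / z) = x"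
    using assms by (simp add: ennreal_times_divide mult_divide_eq_ennreal mult.commute [of z])
  ultimately show "x \<le> z * y" by simp
next
  assume "x \<le> z * y"
  with assms(1) show "x / z \<le> y" by (rule divide_le_posI_ennreal)
qed

text \<open>\<open>Lim\<close> is informative only where the limit exists. Monotone functions into a
  complete linear order have one-sided limits, so the measures become suprema or infima over
  \<open>\<delta>\<close>.\<close>

lemma Lim_at_right_antimono_ennreal:
  fixes f :: "real \<Rightarrow> ennreal"
  assumes "\<And>x y. 0 < x \<Longrightarrow> x \<le> y \<Longrightarrow> f y \<le> f x"
  shows "Lim (at_right 0) f = (SUP x\<in>{0<..}. f x)"
proof (rule tendsto_Lim)
  show "(f \<longlongrightarrow> (SUP x\<in>{0<..}. f x)) (at_right 0)"
  proof (rule order_tendstoI)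
    fix u assume "u < (SUP x\<in>{0<..}. f x)"
    then obtain x where x: "0 < x" "u < f x" by (auto simp: less_SUP_iff)
    then have "u < f y" if "y \<in> {0<..<x}" for y
      using assms [of y x] that by (auto intro: less_le_trans)
    then show "\<forall>\<^sub>F y in at_right 0. u < f y"
      using eventually_at_right_real [OF x(1)] by (auto elim: eventually_mono)
  next
    fix u assume u: "(SUP x\<in>{0<..}. f x) < u"
    show "\<forall>\<^sub>F y in at_right 0. f y < u"
      using eventually_at_right_less
      by eventually_elim (use u in \<open>auto intro: le_less_trans [OF SUP_upper]\<close>)
  qed
qed simp

lemma Lim_at_right_mono_ennreal:
  fixes f :: "real \<Rightarrow> ennreal"
  assumes "\<And>x y. 0 < x \<Longrightarrow> x \<le> y \<Longrightarrow> f x \<le> f y"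
  shows "Lim (at_right 0) f = (INF x\<in>{0<..}. f x)"
proof (rule tendsto_Lim)
  show "(f \<longlongrightarrow> (INF x\<in>{0<..}. f x)) (at_right 0)"
  proof (rule order_tendstoI)
    fix u assume "(INF x\<in>{0<..}. f x) < u"
    then obtain x where x: "0 < x" "f x < u" by (auto simp: INF_less_iff)
    then have "f y < u" if "y \<in> {0<..<x}" for y
      using assms [of y x] that by (auto intro: le_less_trans)
    then show "\<forall>\<^sub>F y in at_right 0. f y < u"
      using eventually_at_right_real [OF x(1)] by (auto elim: eventually_mono)
  next
    fix u assume u: "u < (INF x\<in>{0<..}. f x)"
    show "\<forall>\<^sub>F y in at_right 0. u < f y"
      using eventually_at_right_less
      by eventually_elim (use u in \<open>auto intro: less_le_trans [OF _ INF_lower]\<close>)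
  qed
qed simp

lemma hausdorff_measure_eq_SUP:
  "hausdorff_measure h E =
    (SUP \<delta>\<in>{0<..}. INF U\<in>delta_covers \<delta> E. \<Sum>i. ennreal (h (diameter (U i))))"
  unfolding hausdorff_measure_def
proof (rule Lim_at_right_antimono_ennreal)
  fix x y :: real
  assume "x \<le> y"
  then have "delta_covers x E \<subseteq> delta_covers y E"
    by (auto simp: delta_covers_def intro: order_trans)
  then show "(INF U\<in>delta_covers y E. \<Sum>i. ennreal (h (diameter (U i))))
      \<le> (INF U\<in>delta_covers x E. \<Sum>i. ennreal (h (diameter (U i))))"
    by (rule INF_superset_mono) simp
qed

lemma packing_premeasure_eq_INF:
  "packing_premeasure h E =
    (INF \<delta>\<in>{0<..}. SUP \<B>\<in>delta_packings \<delta> E. \<Sum>\<^sub>\<infinity>B\<in>\<B>. ennreal (h (diameter B)))"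
  unfolding packing_premeasure_def
proof (rule Lim_at_right_mono_ennreal)
  fix x y :: real
  assume "x \<le> y"
  then have "delta_packings x E \<subseteq> delta_packings y E"
    by (auto simp: delta_packings_def)
  then show "(SUP \<B>\<in>delta_packings x E. \<Sum>\<^sub>\<infinity>B\<in>\<B>. ennreal (h (diameter B)))
      \<le> (SUP \<B>\<in>delta_packings y E. \<Sum>\<^sub>\<infinity>B\<in>\<B>. ennreal (h (diameter B)))"
    by (rule SUP_subset_mono) simp
qed

lemma packing_premeasure_empty: "packing_premeasure h {} = 0"
proof -
  have "delta_packings \<delta> {} = {{}}" for \<delta>
    by (auto simp: delta_packings_def)
  then show ?thesis
    by (simp add: packing_premeasure_eq_INF)
qed

text \<open>The decomposition of \<open>E\<close> into itself and empty sets shows this; upper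
  bounds need only the pre-measure.\<close>

lemma packing_measure_le_premeasure: "packing_measure h E \<le> packing_premeasure h E"
proof -
  define F where "F i = (if i = 0 then E else {})" for i :: nat
  have "packing_measure h E \<le> (\<Sum>i. packing_premeasure h (F i))"
    unfolding packing_measure_def by (rule INF_lower) (auto simp: F_def split: if_splits)
  also have "\<dots> = (\<Sum>i\<in>{0}. packing_premeasure h (F i))"
    by (rule suminf_finite) (auto simp: F_def packing_premeasure_empty)
  finally show ?thesis by (simp add: F_def)
qed

section \<open>Elementary properties of dimension functions\<close>

lemma dimension_function_nonneg: "dimension_function_on A h \<Longrightarrow> 0 \<le> h x"
  unfolding dimension_function_on_def by (cases "x \<in> {0<..A}") (auto intro: less_imp_le)

lemma dimension_function_0: "dimension_function_on A h \<Longrightarrow> h 0 = 0"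
  unfolding dimension_function_on_def by simp

lemma dimension_function_mono:
  assumes "dimension_function_on A h" "0 \<le> x" "x \<le> y" "y \<le> A"
  shows "h x \<le> h y"
proof (cases "x = 0 \<or> x = y")
  case True
  then show ?thesis
    using dimension_function_nonneg [OF assms(1)] dimension_function_0 [OF assms(1)] by auto
next
  case False
  then have "h x < h y"
    using assms unfolding dimension_function_on_def
    by (intro strict_mono_onD [of "{0<..A}" h]) auto
  then show ?thesis by simp
qed

lemma dimension_function_doubling:
  assumes "dimension_function_on A h"
  obtains \<tau> where "0 < \<tau>" "\<And>x. 0 < x \<Longrightarrow> 2 * x \<le> A \<Longrightarrow> \<tau> * h (2 * x) \<le> h x"
proof -
  obtain \<tau> where "0 < \<tau>" "\<And>x. x \<in> {0<..A} \<Longrightarrow> 2 * x \<in> {0<..A} \<Longrightarrow> \<tau> * h (2 * x) \<le> h x"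
    using assms unfolding dimension_function_on_def by blast
  then show thesis by (intro that [of \<tau>]) auto
qed

text \<open>Numbers of one parity are never adjacent, and the more frequent parity makes up at least
  half of the set.\<close>

lemma nat_set_same_parity_half:
  fixes S :: "nat set"
  assumes "finite S"
  obtains T where "T \<subseteq> S" "card S \<le> 2 * card T"
    "\<And>p q. p \<in> T \<Longrightarrow> q \<in> T \<Longrightarrow> p < q \<Longrightarrow> p + 2 \<le> q"
proof -
  have S: "S = {p \<in> S. even p} \<union> {p \<in> S. odd p}" by auto
  have "card S \<le> card {p \<in> S. even p} + card {p \<in> S. odd p}"
    by (subst S) (rule card_Un_le)
  then consider "card S \<le> 2 * card {p \<in> S. even p}" | "card S \<le> 2 * card {p \<in> S. odd p}"
    by linarith
  then show thesis
  proof cases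
    case 1
    show thesis by (rule that [OF _ 1]) (auto, presburger)
  next
    case 2
    show thesis by (rule that [OF _ 2]) (auto, presburger)
  qed
qed


section \<open>Uniform mass\<close>

context cantor_sequence
begin

lemma ival_dyadic_index_Suc:
  assumes "0 \<le> t"
  shows "ival (2 ^ Suc k + dyadic_index (Suc k) t) \<subseteq> ival (2 ^ k + dyadic_index k t)"
proof -
  define p where "p = dyadic_index (Suc k) t"
  define n where "n = 2 ^ k + p div 2"
  have "1 \<le> n" by (simp add: n_def Suc_leI)
  moreover have "2 ^ Suc k + p = 2 * n \<or> 2 ^ Suc k + p = 2 * n + 1"
    unfolding n_def power_Suc by presburger
  ultimately have "ival (2 ^ Suc k + p) \<subseteq> ival n"
    using ival_nested by metis
  then show ?thesis
    using dyadic_index_Suc [OF assms, of k] by (simp add: n_def p_def)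
qed

lemma diameter_ival: "1 \<le> n \<Longrightarrow> diameter (ival n) = len n"
  using len_pos [of n] by (simp add: cantor_interval_def)

lemma mem_cantor_set_iff: "x \<in> cantor_set a c \<longleftrightarrow> (\<forall>k. \<exists>p<2 ^ k. x \<in> ival (2 ^ k + p))"
proof -
  have "(\<exists>n\<in>{2 ^ k..<2 ^ (k + 1)}. x \<in> ival n) \<longleftrightarrow> (\<exists>p<2 ^ k. x \<in> ival (2 ^ k + p))" for k
  proof
    assume "\<exists>n\<in>{2 ^ k..<2 ^ (k + 1)}. x \<in> ival n"
    then obtain n where "2 ^ k \<le> n" "n < 2 ^ k + 2 ^ k" "x \<in> ival n" by auto
    then show "\<exists>p<2 ^ k. x \<in> ival (2 ^ k + p)"
      by (intro exI [of _ "n - 2 ^ k"]) auto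
  qed force
  then show ?thesis by (simp add: cantor_set_def)
qed

text \<open>The binary digits of \<open>t\<close> choose a child at each level; the chosen intervals
  are compact and nested, so they share a point. This codes the Cantor set by
  \<open>{0..<1}\<close>.\<close>

lemma cantor_point:
  assumes "t \<in> {0..<1}"
  obtains x where "x \<in> cantor_set a c" "\<And>k. x \<in> ival (2 ^ k + dyadic_index k t)"
proof -
  have "(\<Inter>k. ival (2 ^ k + dyadic_index k t)) \<noteq> {}"
  proof (rule compact_nest)
    fix k
    show "compact (ival (2 ^ k + dyadic_index k t))"
      by (simp add: cantor_interval_def)
    show "ival (2 ^ k + dyadic_index k t) \<noteq> {}"
      using len_pos [of "2 ^ k + dyadic_index k t"] by (simp add: cantor_interval_def Suc_leI)
  next
    fix k m :: nat
    assume km: "k \<le> m"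
    show "ival (2 ^ m + dyadic_index m t) \<subseteq> ival (2 ^ k + dyadic_index k t)"
      by (rule lift_Suc_antimono_le [where f = "\<lambda>k. ival (2 ^ k + dyadic_index k t)",
            OF ival_dyadic_index_Suc km]) (use assms in simp)
  qed
  then obtain x where x: "\<And>k. x \<in> ival (2 ^ k + dyadic_index k t)" by blast
  moreover have "x \<in> cantor_set a c"
    unfolding mem_cantor_set_iff using x dyadic_index_less [of t] assms by auto
  ultimately show thesis by (rule that [rotated])
qed

text \<open>
  The Lebesgue measure of \<open>shadow E\<close> takes the place of the mass that the uniform measure on
  the Cantor set gives to \<open>E\<close>; it makes sense without any measurability assumption on \<open>E\<close>.
\<close>

definition meeting :: "nat \<Rightarrow> real set \<Rightarrow> nat set" where
  "meeting k E = {p. p < 2 ^ k \<and> ival (2 ^ k + p) \<inter> E \<noteq> {}}"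

definition shadow :: "real set \<Rightarrow> real set" where
  "shadow E = (\<Inter>k. \<Union>p\<in>meeting k E. dyadic_cell k p)"

lemma finite_meeting: "finite (meeting k E)"
  by (simp add: meeting_def)

lemma sets_shadow: "shadow E \<in> sets borel"
  unfolding shadow_def by (intro sets.countable_INT'' sets.finite_UN finite_meeting sets_dyadic_cell countableI_type) simp_all

lemma emeasure_shadow_le: "emeasure lborel (shadow E) \<le> ennreal (card (meeting k E) / 2 ^ k)"
proof -
  have "emeasure lborel (shadow E) \<le> emeasure lborel (\<Union>p\<in>meeting k E. dyadic_cell k p)"
    by (rule emeasure_mono) (auto simp: shadow_def intro!: sets.finite_UN finite_meeting sets_dyadic_cell)
  also have "\<dots> \<le> (\<Sum>p\<in>meeting k E. emeasure lborel (dyadic_cell k p))"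
    by (rule emeasure_subadditive_finite) (auto simp: finite_meeting sets_dyadic_cell)
  also have "\<dots> = ennreal (\<Sum>p\<in>meeting k E. 1 / 2 ^ k)"
    unfolding emeasure_dyadic_cell by (rule sum_ennreal) simp
  finally show ?thesis by simp
qed

lemma emeasure_shadow_less_top: "emeasure lborel (shadow E) < top"
  using emeasure_shadow_le [of E 0] by (rule le_less_trans) simp

text \<open>This replaces total mass one with countable subadditivity: the point coded by
  \<open>t\<close> lies in some \<open>F i\<close>, so every interval along the path of
  \<open>t\<close> meets that \<open>F i\<close>.\<close>

lemma suminf_emeasure_shadow_ge_1:
  assumes "cantor_set a c \<subseteq> (\<Union>i. F i)"
  shows "1 \<le> (\<Sum>i :: nat. emeasure lborel (shadow (F i)))"
proof -
  have "{0..<1} \<subseteq> (\<Union>i. shadow (F i))"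
  proof
    fix t :: real
    assume t: "t \<in> {0..<1}"
    then obtain x where x: "x \<in> cantor_set a c" "\<And>k. x \<in> ival (2 ^ k + dyadic_index k t)"
      using cantor_point by blast
    obtain i where i: "x \<in> F i" using x(1) assms by blast
    have "dyadic_index k t \<in> meeting k (F i)" "t \<in> dyadic_cell k (dyadic_index k t)" for k
      using t x(2) [of k] i dyadic_index_less [of t k] mem_dyadic_cell_iff [of t k]
      by (auto simp: meeting_def)
    then show "t \<in> (\<Union>i. shadow (F i))" unfolding shadow_def by blast
  qed
  then have "emeasure lborel {0..<1::real} \<le> emeasure lborel (\<Union>i. shadow (F i))"
    by (rule emeasure_mono) (auto intro!: sets.countable_UN simp: sets_shadow)
  also have "\<dots> \<le> (\<Sum>i. emeasure lborel (shadow (F i)))"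
    by (rule emeasure_subadditive_countably) (auto simp: sets_shadow)
  finally show ?thesis by simp
qed

text \<open>
  Of three intervals of level \<open>k\<close> the middle one has length at least \<open>avg (2 ^ Suc k)\<close>.
\<close>

lemma card_meeting_le_2:
  assumes "bounded U" "diameter U < avg (2 ^ Suc k)"
  shows "card (meeting k U) \<le> 2"
proof (cases "meeting k U = {}")
  case False
  define m where "m = Min (meeting k U)"
  have m: "m \<in> meeting k U" using False finite_meeting by (simp add: m_def)
  have "meeting k U \<subseteq> {m, m + 1}"
  proof
    fix p
    assume p: "p \<in> meeting k U"
    then have "m \<le> p" using finite_meeting by (simp add: m_def)
    obtain x y where xy: "x \<in> ival (2 ^ k + m)" "x \<in> U" "y \<in> ival (2 ^ k + p)" "y \<in> U" "p < 2 ^ k"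
      using m p by (auto simp: meeting_def)
    have "y - x \<le> diameter U"
      using diameter_bounded_bound [OF assms(1) xy(2,4)] by (simp add: dist_real_def)
    then have "\<not> m + 2 \<le> p"
      using ival_separated [OF _ xy(5,1,3)] assms(2) by auto
    with \<open>m \<le> p\<close> show "p \<in> {m, m + 1}" by auto
  qed
  then have "card (meeting k U) \<le> card {m, m + 1}" by (rule card_mono [rotated]) simp
  then show ?thesis by simp
qed simp

section \<open>Locating a length among the mean lengths\<close>

lemma avg_pow2_anti: "i \<le> j \<Longrightarrow> avg (2 ^ j) \<le> avg (2 ^ i)"
  by (rule avg_anti) (simp_all add: Suc_leI)

lemma avg_bracket:
  assumes "0 < d" "d < avg (2 ^ K)"
  obtains k where "K \<le> k" "avg (2 ^ Suc k) \<le> d" "d < avg (2 ^ k)"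
proof -
  have "\<exists>m. avg (2 ^ m) \<le> d"
    using order_tendstoD(2) [OF avg_pow2_tendsto_0 assms(1)]
    by (meson eventually_sequentially less_imp_le order_refl)
  then obtain m where m: "avg (2 ^ m) \<le> d" "\<And>i. i < m \<Longrightarrow> d < avg (2 ^ i)"
    using exists_least_iff [of "\<lambda>m. avg (2 ^ m) \<le> d"] by (auto simp: not_le)
  have "K < m"
    using avg_pow2_anti [of m K] m(1) assms(2) by (metis not_le order_trans nle_le)
  then show thesis
    using that [of "m - 1"] m(1) m(2) [of "m - 1"] by auto
qed

text \<open>Here the lower inequality is strict: an open ball of radius \<open>d\<close> has to
  contain a closed interval of length at most the lower mean. Covering sets need strictness at the
  upper end instead.\<close>

lemma avg_bracket':
  assumes "0 < d" "d \<le> avg (2 ^ K)"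
  obtains k where "K \<le> k" "avg (2 ^ Suc k) < d" "d \<le> avg (2 ^ k)"
proof -
  have "\<exists>m. avg (2 ^ m) < d"
    using order_tendstoD(2) [OF avg_pow2_tendsto_0 assms(1)]
    by (meson eventually_sequentially order_refl)
  then obtain m where m: "avg (2 ^ m) < d" "\<And>i. i < m \<Longrightarrow> d \<le> avg (2 ^ i)"
    using exists_least_iff [of "\<lambda>m. avg (2 ^ m) < d"] by (auto simp: not_less)
  have "K < m"
    using avg_pow2_anti [of m K] m(1) assms(2) by (metis not_le order_trans nle_le)
  then show thesis
    using that [of "m - 1"] m(1) m(2) [of "m - 1"] by auto
qed

end


section \<open>Comparison with the gauge sequence\<close>

text \<open>Two-sided comparison with finite constants preserves the values \<open>0\<close> and
  \<open>top\<close>, which is all that the classes distinguish.\<close>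

lemma comparable_eq_0_top:
  fixes x y :: ennreal
  assumes "x \<le> c * y" "y \<le> d * x" "c < top" "d < top"
  shows "(x = 0 \<longleftrightarrow> y = 0) \<and> (x = top \<longleftrightarrow> y = top)"
  using assms by (auto simp: ennreal_mult_eq_top_iff top_unique)

context cantor_sequence
begin

abbreviation gauge :: "(real \<Rightarrow> real) \<Rightarrow> nat \<Rightarrow> ennreal" where
  "gauge h n \<equiv> ennreal (real n * h (avg n))"

lemma eventually_avg_less: "0 < \<delta> \<Longrightarrow> \<forall>\<^sub>F n in sequentially. avg n < \<delta>"
  by (rule order_tendstoD [OF avg_tendsto_0])

section \<open>Bounds for the Hausdorff measure\<close>

lemma hausdorff_measure_le:
  assumes h: "dimension_function_on A h" "0 < A"
  shows "hausdorff_measure h (cantor_set a c) \<le> 4 * liminf (gauge h)"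
  unfolding hausdorff_measure_eq_SUP
proof (rule SUP_least)
  fix \<delta> :: real
  assume "\<delta> \<in> {0<..}"
  then have "0 < min \<delta> A" using h by simp
  define I where "I = (INF U\<in>delta_covers \<delta> (cantor_set a c). \<Sum>i. ennreal (h (diameter (U i))))"
  have "\<forall>\<^sub>F n in sequentially. I / 4 \<le> gauge h n"
    using eventually_ge_at_top [of 1] eventually_avg_less [OF \<open>0 < min \<delta> A\<close>]
  proof eventually_elim
    case (elim n)
    obtain k where k: "2 ^ k \<le> n" "n < 2 ^ Suc k"
      using ex_power_ivl1 [of 2 n] elim by auto
    \<comment> \<open>Level \<open>k + 2\<close> is the first whose lengths are certainly at most
      \<open>avg (2 ^ Suc k)\<close>, hence at most \<open>avg n\<close>; it has at most
      \<open>4 * n\<close> intervals, whence the constant 4.\<close>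
    define N :: nat where "N = 2 ^ Suc (Suc k)"
    \<comment> \<open>The padding by empty sets costs nothing, as \<open>h 0 = 0\<close>.\<close>
    define U where "U i = (if i < N then ival (N + i) else {})" for i
    have len_le: "len (N + i) \<le> avg n" for i
    proof -
      have "len (N + i) \<le> avg (2 ^ Suc k)" by (rule len_le_avg) (simp add: N_def)
      also have "\<dots> \<le> avg n" by (rule avg_anti) (use elim k in auto)
      finally show ?thesis .
    qed
    have diam: "diameter (U i) = (if i < N then len (N + i) else 0)" for i
      by (simp add: U_def diameter_ival N_def Suc_leI)
    have len_nonneg: "0 \<le> len (N + i)" for i
      by (rule less_imp_le [OF len_pos]) (simp add: N_def Suc_leI)
    have "U \<in> delta_covers \<delta> (cantor_set a c)"
      unfolding delta_covers_def
    proof (intro CollectI conjI allI)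
      show "cantor_set a c \<subseteq> (\<Union>i. U i)"
      proof
        fix x
        assume "x \<in> cantor_set a c"
        then obtain p where "p < N" "x \<in> ival (N + p)"
          unfolding N_def mem_cantor_set_iff by blast
        then have "x \<in> U p" by (simp add: U_def)
        then show "x \<in> (\<Union>i. U i)" by blast
      qed
      show "bounded (U i)" for i by (simp add: U_def cantor_interval_def)
      show "diameter (U i) \<le> \<delta>" for i
        unfolding diam using len_le [of i] elim \<open>0 < min \<delta> A\<close> by simp
    qed
    then have "I \<le> (\<Sum>i. ennreal (h (diameter (U i))))"
      unfolding I_def by (rule INF_lower)
    also have "\<dots> = (\<Sum>i<N. ennreal (h (diameter (U i))))"
      by (rule suminf_finite) (simp_all add: diam dimension_function_0 [OF h(1)])
    also have "\<dots> \<le> (\<Sum>i<N. ennreal (h (avg n)))"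
    proof (intro sum_mono ennreal_leI)
      fix i
      assume "i \<in> {..<N}"
      then show "h (diameter (U i)) \<le> h (avg n)"
        unfolding diam using len_le len_nonneg elim
        by (auto intro!: dimension_function_mono [OF h(1)])
    qed
    also have "\<dots> = ennreal (real N * h (avg n))"
      using dimension_function_nonneg [OF h(1)] by (simp add: ennreal_mult ennreal_of_nat_eq_real_of_nat)
    also have "\<dots> \<le> ennreal (4 * (real n * h (avg n)))"
    proof (intro ennreal_leI)
      have "N \<le> 4 * n" using k by (simp add: N_def)
      then have "real N \<le> 4 * real n" by linarith
      then show "real N * h (avg n) \<le> 4 * (real n * h (avg n))"
        using dimension_function_nonneg [OF h(1)] by (simp add: mult_right_mono mult.assoc [symmetric])
    qed
    also have "\<dots> = 4 * gauge h n"
      using dimension_function_nonneg [OF h(1)] by (subst ennreal_mult) simp_all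
    finally show ?case by (simp add: ennreal_divide_le_iff)
  qed
  then have "I / 4 \<le> liminf (gauge h)" by (rule Liminf_bounded)
  then show "I \<le> 4 * liminf (gauge h)" by (simp add: ennreal_divide_le_iff)
qed

text \<open>A covering set of diameter \<open>0\<close> contributes \<open>h 0 = 0\<close>, so it
  must carry no mass. It meets at most two intervals of each level.\<close>

lemma emeasure_shadow_eq_0:
  assumes "bounded U" "diameter U = 0"
  shows "emeasure lborel (shadow U) = 0"
proof -
  have "emeasure lborel (shadow U) \<le> ennreal (2 * (1 / 2) ^ j)" for j
  proof (rule order_trans [OF emeasure_shadow_le ennreal_leI])
    have "card (meeting j U) \<le> 2"
      using assms avg_pos [of "2 ^ Suc j"] by (intro card_meeting_le_2) simp_all
    then show "card (meeting j U) / 2 ^ j \<le> 2 * (1 / 2) ^ j"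
      by (simp add: power_one_over field_simps)
  qed
  moreover have "(\<lambda>j. ennreal (2 * (1 / 2) ^ j)) \<longlonglongrightarrow> ennreal (2 * 0)"
    by (intro tendsto_ennrealI tendsto_mult tendsto_const LIMSEQ_realpow_zero) simp_all
  ultimately have "emeasure lborel (shadow U) \<le> ennreal (2 * 0)"
    by (intro LIMSEQ_le_const) auto
  then show ?thesis by simp
qed

text \<open>Mass distribution principle: a small set carries at most a constant times
  \<open>h\<close> of its diameter, and a cover carries mass at least \<open>1\<close>.\<close>

lemma liminf_gauge_le:
  assumes h: "dimension_function_on A h" "0 < A"
  shows "liminf (gauge h) \<le> 8 * hausdorff_measure h (cantor_set a c)"
proof (rule dense_le)
  fix \<beta>
  assume "\<beta> < liminf (gauge h)"
  from less_LiminfD [OF this] eventually_avg_less [OF h(2)] eventually_ge_at_top [of 1]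
  have "\<forall>\<^sub>F n in sequentially. \<beta> < gauge h n \<and> avg n < A \<and> 1 \<le> n"
    by eventually_elim simp
  then obtain K where K: "\<And>n. K \<le> n \<Longrightarrow> \<beta> < gauge h n \<and> avg n < A \<and> 1 \<le> n"
    unfolding eventually_sequentially by blast
  \<comment> \<open>One \<open>K\<close> thus serves as threshold both for indices and for
    levels.\<close>
  have pow_ge: "K \<le> 2 ^ k" if "K \<le> k" for k
    using that less_exp [of k] by linarith
  \<comment> \<open>Halving makes \<open>d < avg (2 ^ K)\<close> strict although covers only satisfy
    \<open>diameter \<le> \<delta>\<close>.\<close>
  define \<delta> where "\<delta> = avg (2 ^ K) / 2"
  have \<delta>: "0 < \<delta>" "\<delta> < avg (2 ^ K)" "\<delta> < A"
    using avg_pos [of "2 ^ K"] K [OF pow_ge [OF order_refl]] by (simp_all add: \<delta>_def Suc_leI)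
  have "\<beta> / 8 \<le> (\<Sum>i. ennreal (h (diameter (U i))))" if U: "U \<in> delta_covers \<delta> (cantor_set a c)" for U
  proof -
    have cover: "cantor_set a c \<subseteq> (\<Union>i. U i)" and bdd: "\<And>i. bounded (U i)"
      and diam: "\<And>i. diameter (U i) \<le> \<delta>"
      using U by (auto simp: delta_covers_def)
    have piece: "\<beta> * emeasure lborel (shadow (U i)) \<le> 8 * ennreal (h (diameter (U i)))" for i
    proof (cases "diameter (U i) = 0")
      case True
      then show ?thesis using emeasure_shadow_eq_0 [OF bdd] by simp
    next
      case False
      define d where "d = diameter (U i)"
      have d: "0 < d" "d < avg (2 ^ K)"
        using False diameter_ge_0 [OF bdd, of i] diam [of i] \<delta> by (auto simp: d_def)
      obtain k where k: "K \<le> k" "avg (2 ^ Suc k) \<le> d" "d < avg (2 ^ k)"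
        using avg_bracket [OF d] by blast
      have "1 \<le> K"
        using K [of K] by simp
      \<comment> \<open>Meetings are counted one level up, where \<open>d < avg (2 ^ Suc j)\<close>
        allows at most two; the constant is \<open>2 ^ Suc k * (2 / 2 ^ j) = 8\<close>.\<close>
      then obtain j where j: "k = Suc j" using k(1) by (cases k) auto
      have "card (meeting j (U i)) \<le> 2"
        using k(3) by (intro card_meeting_le_2 bdd) (simp add: d_def j)
      then have "emeasure lborel (shadow (U i)) \<le> ennreal (2 / 2 ^ j)"
        by (intro order_trans [OF emeasure_shadow_le [of _ j] ennreal_leI] divide_right_mono) simp_all
      moreover have "\<beta> \<le> ennreal (2 ^ Suc k * h d)"
      proof -
        have "\<beta> \<le> gauge h (2 ^ Suc k)" using K [OF pow_ge [of "Suc k"]] k(1) by (auto intro: less_imp_le)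
        also have "\<dots> \<le> ennreal (2 ^ Suc k * h d)"
        proof (intro ennreal_leI)
          have "h (avg (2 ^ Suc k)) \<le> h d"
            using avg_pos [of "2 ^ Suc k"] k(2) diam [of i] \<delta>(3)
            by (intro dimension_function_mono [OF h(1)]) (simp_all add: d_def)
          then show "real (2 ^ Suc k) * h (avg (2 ^ Suc k)) \<le> 2 ^ Suc k * h d" by simp
        qed
        finally show ?thesis .
      qed
      ultimately have "\<beta> * emeasure lborel (shadow (U i)) \<le> ennreal (2 ^ Suc k * h d) * ennreal (2 / 2 ^ j)"
        by (intro mult_mono) simp_all
      also have "\<dots> = ennreal (8 * h d)"
        using dimension_function_nonneg [OF h(1), of d] by (simp add: ennreal_mult [symmetric] j)
      also have "\<dots> = 8 * ennreal (h d)"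
        using dimension_function_nonneg [OF h(1), of d] by (simp add: ennreal_mult)
      finally show ?thesis by (simp add: d_def)
    qed
    have "\<beta> * 1 \<le> \<beta> * (\<Sum>i. emeasure lborel (shadow (U i)))"
      by (intro mult_left_mono suminf_emeasure_shadow_ge_1 cover) simp
    also have "\<dots> = (\<Sum>i. \<beta> * emeasure lborel (shadow (U i)))" by simp
    also have "\<dots> \<le> (\<Sum>i. 8 * ennreal (h (diameter (U i))))"
      by (intro suminf_le piece) simp_all
    finally show ?thesis by (simp add: ennreal_divide_le_iff)
  qed
  then have "\<beta> / 8 \<le> hausdorff_measure h (cantor_set a c)"
    unfolding hausdorff_measure_eq_SUP
    by (intro SUP_upper2 [of \<delta>] INF_greatest) (use \<delta> in auto)
  then show "\<beta> \<le> 8 * hausdorff_measure h (cantor_set a c)"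
    by (simp add: ennreal_divide_le_iff)
qed

section \<open>Bounds for the packing measure\<close>

text \<open>Each ball of a packing contains an interval on the scale of its radius. Disjoint balls
  give disjoint dyadic cells, whose total length is at most \<open>1\<close>.\<close>

lemma packing_measure_le:
  assumes h: "dimension_function_on A h" "0 < A"
    and \<tau>: "0 < \<tau>" "\<And>x. 0 < x \<Longrightarrow> 2 * x \<le> A \<Longrightarrow> \<tau> * h (2 * x) \<le> h x"
  shows "packing_measure h (cantor_set a c) \<le> ennreal (4 / \<tau>) * limsup (gauge h)"
proof -
  let ?C = "cantor_set a c"
  have "packing_premeasure h ?C / ennreal (4 / \<tau>) \<le> \<beta>" if \<beta>: "limsup (gauge h) < \<beta>" for \<beta>
  proof (cases \<beta>)
    case top
    then show ?thesis by simp
  next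
    case (real b)
    from Limsup_lessD [OF \<beta>] eventually_avg_less [OF h(2)]
    have "\<forall>\<^sub>F n in sequentially. gauge h n < \<beta> \<and> avg n < A"
      by eventually_elim simp
    then obtain K where K: "\<And>n. K \<le> n \<Longrightarrow> gauge h n < \<beta> \<and> avg n < A"
      unfolding eventually_sequentially by blast
    \<comment> \<open>The bound \<open>A\<close> makes doubling applicable to \<open>2 * r\<close>;
      the other bound puts the radius at a level where the gauge is already below
      \<open>\<beta>\<close>.\<close>
    define \<delta> where "\<delta> = min A (avg (2 ^ K))"
    have "0 < \<delta>" using h(2) avg_pos [of "2 ^ K"] by (simp add: \<delta>_def Suc_leI)
    have "(\<Sum>\<^sub>\<infinity>B\<in>\<B>. ennreal (h (diameter B))) \<le> ennreal (4 / \<tau>) * \<beta>"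
      if \<B>: "\<B> \<in> delta_packings \<delta> ?C" for \<B>
    proof (rule infsum_le_finite_sums)
      fix F
      assume F: "finite F" "F \<subseteq> \<B>"
      have packing: "disjoint \<B>"
        "\<And>B. B \<in> \<B> \<Longrightarrow> (\<exists>x\<in>?C. \<exists>r>0. B = ball x r) \<and> diameter B < \<delta>"
        using \<B> by (simp_all only: delta_packings_def mem_Collect_eq)
      have "\<exists>k p. p < 2 ^ k \<and> ival (2 ^ k + p) \<subseteq> B \<and> h (diameter B) \<le> 4 / \<tau> * b * (1 / 2 ^ k)"
        if "B \<in> F" for B
      proof -
        obtain x r where xr: "x \<in> ?C" "0 < r" "B = ball x r" and diam: "diameter B < \<delta>"
          using packing(2) [OF subsetD [OF F(2) \<open>B \<in> F\<close>]] by blast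
        have r: "2 * r < A" "r \<le> avg (2 ^ K)"
          using diam xr by (simp_all add: \<delta>_def)
        obtain k where k: "K \<le> k" "avg (2 ^ Suc k) < r" "r \<le> avg (2 ^ k)"
          using avg_bracket' [OF xr(2) r(2)] by blast
        obtain p where p: "p < 2 ^ Suc (Suc k)" "x \<in> ival (2 ^ Suc (Suc k) + p)"
          using xr(1) unfolding mem_cantor_set_iff by blast
        have "len (2 ^ Suc (Suc k) + p) \<le> avg (2 ^ Suc k)"
          by (rule len_le_avg) simp
        with k(2) have "len (2 ^ Suc (Suc k) + p) < r" by simp
        then have "ival (2 ^ Suc (Suc k) + p) \<subseteq> B"
          using p(2) unfolding xr(3) by (auto simp: cantor_interval_def dist_real_def)
        moreover have "h (diameter B) \<le> 4 / \<tau> * b * (1 / 2 ^ Suc (Suc k))"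
        proof -
          have "K \<le> 2 ^ k" using k(1) less_exp [of k] by linarith
          note K = K [OF this]
          \<comment> \<open>Doubling passes from the diameter of the ball to its radius, which is
            the quantity that was bracketed.\<close>
          have "\<tau> * h (2 * r) \<le> h r" using \<tau>(2) xr r by simp
          also have "\<dots> \<le> h (avg (2 ^ k))"
            using xr k K by (intro dimension_function_mono [OF h(1)]) auto
          also have "\<dots> \<le> b / 2 ^ k"
          proof -
            have "2 ^ k * h (avg (2 ^ k)) < b"
              using K real dimension_function_nonneg [OF h(1)] by (simp add: ennreal_less_iff)
            then show ?thesis by (simp add: field_simps)
          qed
          finally show ?thesis using xr \<tau>(1) by (simp add: field_simps)
        qed
        ultimately show ?thesis using p(1) by blast
      qed
      then obtain k p where kp: "\<And>B. B \<in> F \<Longrightarrow> p B < 2 ^ k B"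
        "\<And>B. B \<in> F \<Longrightarrow> ival (2 ^ k B + p B) \<subseteq> B"
        "\<And>B. B \<in> F \<Longrightarrow> h (diameter B) \<le> 4 / \<tau> * b * (1 / 2 ^ k B)"
        by metis
      \<comment> \<open>A parameter \<open>t\<close> in two cells would code a point lying in both
        balls.\<close>
      have disj: "disjoint_family_on (\<lambda>B. dyadic_cell (k B) (p B)) F"
        unfolding disjoint_family_on_def
      proof (intro ballI impI equals0I)
        fix B B' t
        assume B: "B \<in> F" "B' \<in> F" "B \<noteq> B'"
          and t: "t \<in> dyadic_cell (k B) (p B) \<inter> dyadic_cell (k B') (p B')"
        have t01: "t \<in> {0..<1}" using t dyadic_cell_subset_unit [OF kp(1) [OF B(1)]] by blast
        obtain x where x: "\<And>k. x \<in> ival (2 ^ k + dyadic_index k t)"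
          using cantor_point [OF t01] by blast
        have "x \<in> B" "x \<in> B'"
          using t t01 x [of "k B"] x [of "k B'"] kp(2) [OF B(1)] kp(2) [OF B(2)]
          by (auto simp: mem_dyadic_cell_iff)
        moreover have "B \<inter> B' = {}"
          using packing(1) F(2) B unfolding disjoint_def by blast
        ultimately show False by blast
      qed
      have "(\<Sum>B\<in>F. ennreal (h (diameter B)))
          \<le> (\<Sum>B\<in>F. ennreal (4 / \<tau> * b) * emeasure lborel (dyadic_cell (k B) (p B)))"
        using kp(3) \<tau>(1) real
        by (intro sum_mono) (simp add: emeasure_dyadic_cell ennreal_mult [symmetric] ennreal_leI)
      also have "\<dots> = ennreal (4 / \<tau> * b) * emeasure lborel (\<Union>B\<in>F. dyadic_cell (k B) (p B))"
        using disj F(1)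
        by (subst sum_emeasure [symmetric]) (auto simp: sum_distrib_left sets_dyadic_cell)
      also have "\<dots> \<le> ennreal (4 / \<tau> * b) * emeasure lborel {0..<1::real}"
        by (intro mult_left_mono emeasure_mono UN_least dyadic_cell_subset_unit kp(1)) simp_all
      also have "\<dots> = ennreal (4 / \<tau>) * \<beta>"
        using \<tau>(1) real by (simp add: ennreal_mult [symmetric])
      finally show "(\<Sum>B\<in>F. ennreal (h (diameter B))) \<le> ennreal (4 / \<tau>) * \<beta>" .
    qed (rule nonneg_summable_on_complete, simp)
    then have "packing_premeasure h ?C \<le> ennreal (4 / \<tau>) * \<beta>"
      unfolding packing_premeasure_eq_INF
      by (intro INF_lower2 [of \<delta>] SUP_least) (use \<open>0 < \<delta>\<close> in auto)
    then show ?thesis using \<tau>(1) by (simp add: ennreal_divide_le_iff)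
  qed
  then have "packing_premeasure h ?C / ennreal (4 / \<tau>) \<le> limsup (gauge h)"
    by (rule dense_ge)
  then have "packing_premeasure h ?C \<le> ennreal (4 / \<tau>) * limsup (gauge h)"
    using \<tau>(1) by (simp add: ennreal_divide_le_iff)
  then show ?thesis using packing_measure_le_premeasure order_trans by blast
qed

text \<open>
  Two points of \<open>E\<close> in different intervals of level \<open>j\<close> may be arbitrarily close; for intervals
  with positions of the same parity, a whole interval of level \<open>j\<close> lies between them.
\<close>

lemma packing_ge_meeting:
  assumes h: "\<And>x. 0 \<le> h x"
    and n: "2 ^ Suc j \<le> n" "n < 2 ^ Suc (Suc j)" "avg n < \<delta>"
  shows "gauge h n * ennreal (card (meeting j E) / 2 ^ j)
    \<le> 8 * (SUP \<B>\<in>delta_packings \<delta> E. \<Sum>\<^sub>\<infinity>B\<in>\<B>. ennreal (h (diameter B)))"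
proof -
  obtain T where T: "T \<subseteq> meeting j E" "card (meeting j E) \<le> 2 * card T"
    "\<And>p q. p \<in> T \<Longrightarrow> q \<in> T \<Longrightarrow> p < q \<Longrightarrow> p + 2 \<le> q"
    using nat_set_same_parity_half [OF finite_meeting] by blast
  then have "\<forall>p\<in>T. p < 2 ^ j \<and> (\<exists>x. x \<in> ival (2 ^ j + p) \<and> x \<in> E)"
    by (auto simp: meeting_def)
  then obtain x where x: "\<And>p. p \<in> T \<Longrightarrow> p < 2 ^ j" "\<And>p. p \<in> T \<Longrightarrow> x p \<in> ival (2 ^ j + p)"
    "\<And>p. p \<in> T \<Longrightarrow> x p \<in> E"
    by metis
  have "1 \<le> (2::nat) ^ Suc j" by (simp add: Suc_leI)
  then have "1 \<le> n" using n by linarith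
  then have avg: "0 < avg n" "avg n \<le> avg (2 ^ Suc j)"
    using n \<open>1 \<le> 2 ^ Suc j\<close> by (auto intro: avg_pos avg_anti)
  have sep: "avg n < x q - x p" if "p \<in> T" "q \<in> T" "p < q" for p q
    using ival_separated [OF T(3) [OF that] x(1) x(2) x(2)] that avg by simp
  \<comment> \<open>With this radius each ball has diameter exactly \<open>avg n\<close> and so
    contributes \<open>h (avg n)\<close>, while the centres are more than \<open>avg n\<close>
    apart.\<close>
  define ballp where "ballp p = ball (x p) (avg n / 2)" for p
  have ball_disj: "ballp p \<inter> ballp q = {}" if "p \<in> T" "q \<in> T" "p \<noteq> q" for p q
    using sep [OF that(1,2)] sep [OF that(2,1)] that(3)
    by (cases "p < q") (auto simp: ballp_def dist_real_def abs_if field_simps split: if_splits)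
  have mem_ballp: "x p \<in> ballp p" for p using avg by (simp add: ballp_def)
  have inj: "inj_on ballp T"
    using ball_disj mem_ballp by (intro inj_onI) (metis IntI empty_iff)
  have diam: "diameter (ballp p) = avg n" for p
    using avg by (simp add: ballp_def)
  have "ballp ` T \<in> delta_packings \<delta> E"
    unfolding delta_packings_def
  proof (intro CollectI conjI ballI)
    show "disjoint (ballp ` T)" using ball_disj unfolding disjoint_def by auto
  next
    fix B
    assume "B \<in> ballp ` T"
    then obtain p where p: "p \<in> T" "B = ballp p" by blast
    show "\<exists>x\<in>E. \<exists>r>0. B = ball x r"
      using x(3) [OF p(1)] avg p(2) by (auto simp: ballp_def intro!: bexI [of _ "x p"] exI [of _ "avg n / 2"])
    show "diameter B < \<delta>" using diam p n by simp
  qed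
  then have sup: "(\<Sum>\<^sub>\<infinity>B\<in>ballp ` T. ennreal (h (diameter B)))
      \<le> (SUP \<B>\<in>delta_packings \<delta> E. \<Sum>\<^sub>\<infinity>B\<in>\<B>. ennreal (h (diameter B)))"
    by (rule SUP_upper)
  have "finite T" using T(1) finite_meeting finite_subset by blast
  have "gauge h n * ennreal (card (meeting j E) / 2 ^ j)
      = ennreal (real n / 2 ^ j * real (card (meeting j E)) * h (avg n))"
    using h by (simp add: ennreal_mult [symmetric] mult_ac)
  \<comment> \<open>The factor 4 comes from \<open>n < 2 ^ (j + 2)\<close>, the factor 2 from
    keeping one parity only.\<close>
  also have "\<dots> \<le> ennreal (4 * (2 * real (card T)) * h (avg n))"
  proof (intro ennreal_leI mult_right_mono mult_mono h)
    have "real n \<le> real (2 ^ Suc (Suc j))" using n(2) by (simp only: of_nat_le_iff)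
    then show "real n / 2 ^ j \<le> 4" by (simp add: divide_le_eq)
  qed (use T(2) in auto)
  also have "\<dots> = 8 * (\<Sum>p\<in>T. ennreal (h (diameter (ballp p))))"
    using h by (simp add: diam ennreal_mult ennreal_of_nat_eq_real_of_nat mult_ac)
  also have "\<dots> = 8 * (\<Sum>\<^sub>\<infinity>B\<in>ballp ` T. ennreal (h (diameter B)))"
    using \<open>finite T\<close> by (simp add: sum.reindex [OF inj])
  also have "\<dots> \<le> 8 * (SUP \<B>\<in>delta_packings \<delta> E. \<Sum>\<^sub>\<infinity>B\<in>\<B>. ennreal (h (diameter B)))"
    by (intro mult_left_mono sup) simp
  finally show ?thesis .
qed

text \<open>For every \<open>\<delta>\<close>, all large \<open>n\<close> give packings at scale
  \<open>avg n\<close>, so the largest gauge values can be used; the number of intervals meeting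
  \<open>E\<close> is bounded below by its mass at each level.\<close>

lemma packing_premeasure_ge:
  assumes h: "\<And>x. 0 \<le> h x"
  shows "limsup (gauge h) * emeasure lborel (shadow E) \<le> 8 * packing_premeasure h E"
\<comment> \<open>The null case is split off because the estimate divides by the mass.\<close>
proof (cases "emeasure lborel (shadow E) = 0")
  case False
  define m where "m = emeasure lborel (shadow E)"
  have m: "0 < m" "m < top"
    using False emeasure_shadow_less_top by (simp_all add: m_def zero_less_iff_neq_zero)
  have "limsup (gauge h) * m / 8 \<le> (SUP \<B>\<in>delta_packings \<delta> E. \<Sum>\<^sub>\<infinity>B\<in>\<B>. ennreal (h (diameter B)))"
    (is "_ \<le> ?S") if "0 < \<delta>" for \<delta>
  proof -
    have "\<forall>\<^sub>F n in sequentially. gauge h n \<le> 8 * ?S / m"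
      using eventually_ge_at_top [of 2] eventually_avg_less [OF that]
    proof eventually_elim
      case (elim n)
      obtain k where k: "2 ^ k \<le> n" "n < 2 ^ Suc k"
        using ex_power_ivl1 [of 2 n] elim by auto
      have "k \<noteq> 0" using k(2) elim(1) by (intro notI) simp
      then obtain j where j: "k = Suc j" by (cases k) auto
      have "gauge h n * m \<le> gauge h n * ennreal (card (meeting j E) / 2 ^ j)"
        unfolding m_def by (intro mult_left_mono emeasure_shadow_le) simp
      also have "\<dots> \<le> 8 * ?S"
        using packing_ge_meeting [where h = h, OF h] k elim(2) unfolding j by blast
      finally have "gauge h n * m / m \<le> 8 * ?S / m" by (rule divide_right_mono_ennreal)
      then show ?case using m by (simp add: mult_divide_eq_ennreal)
    qed
    then have "limsup (gauge h) \<le> 8 * ?S / m" by (rule Limsup_bounded)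
    then have "limsup (gauge h) * m \<le> 8 * ?S / m * m" by (rule mult_right_mono) simp
    also have "\<dots> = 8 * ?S"
      using m by (simp add: ennreal_divide_times)
    finally show ?thesis by (simp add: ennreal_divide_le_iff)
  qed
  then have "limsup (gauge h) * m / 8 \<le> packing_premeasure h E"
    unfolding packing_premeasure_eq_INF by (intro INF_greatest) auto
  then show ?thesis by (simp add: ennreal_divide_le_iff m_def)
qed simp

text \<open>The previous bound holds for every set and is linear in the mass, so it can be summed
  over any decomposition of the Cantor set.\<close>

lemma limsup_gauge_le:
  assumes h: "\<And>x. 0 \<le> h x"
  shows "limsup (gauge h) \<le> 8 * packing_measure h (cantor_set a c)"
proof -
  have "limsup (gauge h) / 8 \<le> (\<Sum>i. packing_premeasure h (F i))"
    if "cantor_set a c = (\<Union>i. F i)" for F :: "nat \<Rightarrow> real set"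
  proof -
    have "limsup (gauge h) * 1 \<le> limsup (gauge h) * (\<Sum>i. emeasure lborel (shadow (F i)))"
      using that by (intro mult_left_mono suminf_emeasure_shadow_ge_1) simp_all
    also have "\<dots> = (\<Sum>i. limsup (gauge h) * emeasure lborel (shadow (F i)))" by simp
    also have "\<dots> \<le> (\<Sum>i. 8 * packing_premeasure h (F i))"
      by (intro suminf_le packing_premeasure_ge h) simp_all
    finally show ?thesis by (simp add: ennreal_divide_le_iff)
  qed
  then have "limsup (gauge h) / 8 \<le> packing_measure h (cantor_set a c)"
    unfolding packing_measure_def by (intro INF_greatest) auto
  then show ?thesis by (simp add: ennreal_divide_le_iff)
qed

section \<open>Transfer to the classes of dimension functions\<close>

lemma hausdorff_measure_comparable:
  assumes "h \<in> dimension_functions"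
  shows "(hausdorff_measure h (cantor_set a c) = 0 \<longleftrightarrow> liminf (gauge h) = 0) \<and>
    (hausdorff_measure h (cantor_set a c) = top \<longleftrightarrow> liminf (gauge h) = top)"
proof -
  obtain A where "dimension_function_on A h" "0 < A"
    using assms unfolding dimension_functions_def by blast
  then show ?thesis
    by (intro comparable_eq_0_top [OF hausdorff_measure_le liminf_gauge_le]) simp_all
qed

lemma packing_measure_comparable:
  assumes "h \<in> dimension_functions"
  shows "(packing_measure h (cantor_set a c) = 0 \<longleftrightarrow> limsup (gauge h) = 0) \<and>
    (packing_measure h (cantor_set a c) = top \<longleftrightarrow> limsup (gauge h) = top)"
proof -
  obtain A where h: "dimension_function_on A h" "0 < A"
    using assms unfolding dimension_functions_def by blast
  obtain \<tau> where \<tau>: "0 < \<tau>" "\<And>x. 0 < x \<Longrightarrow> 2 * x \<le> A \<Longrightarrow> \<tau> * h (2 * x) \<le> h x"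
    using dimension_function_doubling [OF h(1)] by blast
  show ?thesis
    by (rule comparable_eq_0_top [OF packing_measure_le [OF h \<tau>]
          limsup_gauge_le [OF dimension_function_nonneg [OF h(1)]]]) simp_all
qed

end

theorem theorem4p1:
  fixes a :: "nat \<Rightarrow> real" and c :: real
  assumes "\<And>n. 1 \<le> n \<Longrightarrow> 0 < a n"
    and "\<And>m n. 1 \<le> m \<Longrightarrow> m \<le> n \<Longrightarrow> a n \<le> a m"
    and "summable a"
  shows "(\<forall>\<alpha>\<in>{0, \<infinity>}. hausdorff_class \<alpha> (cantor_set a c) =
            {h \<in> dimension_functions.
               liminf (\<lambda>n. ennreal (real n * h (tail_sum a n / real n))) = \<alpha>}) \<and>
         hausdorff_class_pos_fin (cantor_set a c) =
            {h \<in> dimension_functions.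
               0 < liminf (\<lambda>n. ennreal (real n * h (tail_sum a n / real n))) \<and>
               liminf (\<lambda>n. ennreal (real n * h (tail_sum a n / real n))) < \<infinity>} \<and>
         (\<forall>\<beta>\<in>{0, \<infinity>}. packing_class \<beta> (cantor_set a c) =
            {h \<in> dimension_functions.
               limsup (\<lambda>n. ennreal (real n * h (tail_sum a n / real n))) = \<beta>}) \<and>
         packing_class_pos_fin (cantor_set a c) =
            {h \<in> dimension_functions.
               0 < limsup (\<lambda>n. ennreal (real n * h (tail_sum a n / real n))) \<and>
               limsup (\<lambda>n. ennreal (real n * h (tail_sum a n / real n))) < \<infinity>}"
proof -
  interpret cantor_sequence a c
    using assms by unfold_locales
  \<comment> \<open>Positive and finite means neither \<open>0\<close> nor \<open>top\<close>, so
    the equivalences for these two values settle the remaining classes as well.\<close>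
  show ?thesis
    using hausdorff_measure_comparable packing_measure_comparable
    unfolding avg_def hausdorff_class_def hausdorff_class_pos_fin_def packing_class_def
      packing_class_pos_fin_def infinity_ennreal_def
    by (auto simp: zero_less_iff_neq_zero less_top [symmetric])
qed

end
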